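(* Let $X=\{(z_1,z_2)\in\mathbb{C}^2\mid|z_1|^2+|z_2|^2/2<1\}$ be the symplectic ellipsoid with moment map $\Phi(z_1,z_2)=(|z_1|^2,|z_2|^2)$, so that $\Phi(X)=\{(\lambda_1,\lambda_2)\in\mathbb{R}^2\mid\lambda_1\ge0,\ \lambda_2\ge0,\ 2\lambda_1+\lambda_2<2,\ \lambda_1<1\}$. For $\lambda\in\operatorname{int}(\Phi(X))$, real numbers $\epsilon_1\le-2$, $\epsilon_2\le-1$, and $\delta=(\delta_1,\delta_2)\in\Lambda_0^2$, consider the potential $W_{\lambda,\epsilon,\delta}:\Lambda_0^2\to\Lambda_0$, $$W_{\lambda,\epsilon,\delta}(b)=q^{\lambda_1}e^{b_1}+q^{\lambda_2}e^{b_2}+q^{-2\lambda_1-\lambda_2-\epsilon_1}e^{-2b_1-b_2-\delta_1}+q^{-\lambda_1-\epsilon_2}e^{-b_1-\delta_2}.$$ Then $W_{\lambda,\epsilon,\delta}$ has a critical point for some such $\epsilon,\delta$ if and only if $\lambda_1+\lambda_2\ge1$ and $\lambda_1\ge1/2$.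
   Context: $\Lambda_0$ is the ring of sums $\sum_{n=0}^\infty c_nq^{d_n}$ with $q$ a formal variable, $c_n\in\mathbb{C}$, $d_n\in\mathbb{R}_{\ge0}$, $\lim_{n\to\infty}d_n=\infty$; the exponential of an element of $\Lambda_0$ is again an element of $\Lambda_0$. A critical point is a $b=(b_1,b_2)\in\Lambda_0^2$ at which both partial derivatives $\partial W/\partial b_1$ and $\partial W/\partial b_2$ vanish in $\Lambda_0$. *)

theory Defs
  imports "HOL-Analysis.Analysis"
begin

section \<open>The ring of Novikov sums\<close>

text \<open>
  A sum of the form \<open>\<Sum>n. c\<^sub>n q^d\<^sub>n\<close> is represented by the function sending an exponent \<open>x\<close>
  to the total coefficient of \<open>q^x\<close>. Repetitions among the \<open>d\<^sub>n\<close> are allowed; each exponent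
  occurs only finitely often because \<open>d\<^sub>n\<close> tends to infinity.
\<close>

definition sum_coeff :: "(nat \<Rightarrow> complex) \<Rightarrow> (nat \<Rightarrow> real) \<Rightarrow> real \<Rightarrow> complex" where
  "sum_coeff c d x = (\<Sum>n | d n = x. c n)"

typedef novikov =
  "{sum_coeff c d |c d. (\<forall>n. 0 \<le> d n) \<and> filterlim d at_top sequentially}"
  morphisms coeff Abs_novikov
proof -
  have "sum_coeff (\<lambda>_. 0) real \<in>
      {sum_coeff c d |c d. (\<forall>n. 0 \<le> d n) \<and> filterlim d at_top sequentially}"
    using filterlim_real_sequentially by fastforce
  then show ?thesis by blast
qed

definition locally_finite :: "(real \<Rightarrow> complex) \<Rightarrow> bool" where
  "locally_finite a \<longleftrightarrow> (\<forall>x<0. a x = 0) \<and> (\<forall>E. finite {x. a x \<noteq> 0 \<and> x \<le> E})"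

lemma novikov_set_iff:
  "a \<in> {sum_coeff c d |c d. (\<forall>n. 0 \<le> d n) \<and> filterlim d at_top sequentially}
     \<longleftrightarrow> locally_finite a"
proof
  assume "a \<in> {sum_coeff c d |c d. (\<forall>n. 0 \<le> d n) \<and> filterlim d at_top sequentially}"
  then obtain c d where a: "a = sum_coeff c d" and d0: "\<And>n. 0 \<le> d n"
    and lim: "filterlim d at_top sequentially" by blast
  have fin: "finite {n. d n \<le> E}" for E
  proof -
    from lim have "\<forall>\<^sub>F n in sequentially. E + 1 \<le> d n"
      by (simp add: filterlim_at_top)
    then obtain N where N: "\<And>n. n \<ge> N \<Longrightarrow> E + 1 \<le> d n"
      by (auto simp: eventually_sequentially)
    have "{n. d n \<le> E} \<subseteq> {..<N}"
    proof
      fix n assume "n \<in> {n. d n \<le> E}"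
      then have "\<not> E + 1 \<le> d n" by simp
      then have "\<not> N \<le> n" using N by blast
      then show "n \<in> {..<N}" by simp
    qed
    then show ?thesis using finite_subset by blast
  qed
  have mem: "x \<in> range d" if "a x \<noteq> 0" for x
  proof (rule ccontr)
    assume "x \<notin> range d"
    then have "{n. d n = x} = {}" by auto
    then show False using that by (simp add: a sum_coeff_def)
  qed
  have "a x = 0" if "x < 0" for x
    using mem[of x] d0 that by (metis imageE not_less)
  moreover have "finite {x. a x \<noteq> 0 \<and> x \<le> E}" for E
  proof (rule finite_subset)
    show "{x. a x \<noteq> 0 \<and> x \<le> E} \<subseteq> d ` {n. d n \<le> E}" using mem by blast
    show "finite (d ` {n. d n \<le> E})" using fin by blast
  qed
  ultimately show "locally_finite a" by (simp add: locally_finite_def)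
next
  assume lf: "locally_finite a"
  define S where "S = {x. a x \<noteq> 0} \<union> range real"
  have finE: "finite {x \<in> S. x \<le> E}" for E
  proof -
    have "{x \<in> S. x \<le> E} \<subseteq> {x. a x \<noteq> 0 \<and> x \<le> E} \<union> real ` {..nat \<lfloor>E\<rfloor>}"
      unfolding S_def by (auto simp: le_nat_floor)
    moreover have "finite ({x. a x \<noteq> 0 \<and> x \<le> E} \<union> real ` {..nat \<lfloor>E\<rfloor>})"
      using lf by (simp add: locally_finite_def)
    ultimately show ?thesis using finite_subset by blast
  qed
  have S0: "0 \<le> x" if "x \<in> S" for x
  proof (rule ccontr)
    assume "\<not> 0 \<le> x"
    then have "x < 0" by simp
    then show False using that lf unfolding S_def locally_finite_def by auto
  qed
  have "S = (\<Union>n::nat. {x \<in> S. x \<le> real n})"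
    using real_arch_simple by fast
  moreover have "countable (\<Union>n::nat. {x \<in> S. x \<le> real n})"
    using finE by (simp add: countable_finite)
  ultimately have "countable S" by simp
  moreover have "infinite S"
  proof
    assume "finite S"
    then have "finite (range real)" unfolding S_def by simp
    then show False using range_inj_infinite[OF inj_of_nat] by blast
  qed
  ultimately have bij: "bij_betw (from_nat_into S) UNIV S"
    by (rule bij_betw_from_nat_into)
  define d where "d = from_nat_into S"
  have dS: "d n \<in> S" for n using bij by (auto simp: d_def bij_betw_def)
  have inj: "inj d" using bij by (auto simp: d_def bij_betw_def)
  have "filterlim d at_top sequentially"
    unfolding filterlim_at_top
  proof
    fix Z
    have "finite (d -` {x \<in> S. x \<le> Z})"
      using finE inj by (rule finite_vimageI)
    then have "finite {n. d n < Z}"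
      by (rule rev_finite_subset) (use dS in auto)
    then have "\<forall>\<^sub>F n in sequentially. \<not> d n < Z"
      by (simp add: cofinite_eq_sequentially[symmetric] eventually_cofinite)
    then show "\<forall>\<^sub>F n in sequentially. Z \<le> d n" by (simp add: not_less)
  qed
  moreover have "a = sum_coeff (a \<circ> d) d"
  proof
    fix x
    show "a x = sum_coeff (a \<circ> d) d x"
    proof (cases "x \<in> S")
      case True
      then obtain n where n: "d n = x"
        using bij unfolding d_def bij_betw_def by (metis imageE)
      then have "{m. d m = x} = {n}" using inj by (auto simp: inj_def)
      then show ?thesis using n by (simp add: sum_coeff_def)
    next
      case False
      then have "{m. d m = x} = {}" using dS by blast
      then show ?thesis using False by (auto simp: sum_coeff_def S_def)
    qed
  qed
  ultimately show "a \<in> {sum_coeff c d |c d. (\<forall>n. 0 \<le> d n) \<and> filterlim d at_top sequentially}"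
    using dS S0 by blast
qed

lemmas novikov_ex_iff = novikov_set_iff[unfolded mem_Collect_eq]

lemma locally_finite_coeff: "locally_finite (coeff a)"
  using coeff[of a] unfolding novikov_set_iff .

lemma coeff_neg: "x < 0 \<Longrightarrow> coeff a x = 0"
  using locally_finite_coeff[of a] by (simp add: locally_finite_def)

lemma finite_support: "finite {x. coeff a x \<noteq> 0 \<and> x \<le> E}"
  using locally_finite_coeff[of a] by (simp add: locally_finite_def)

lemma novikov_eqI: "(\<And>x. coeff a x = coeff b x) \<Longrightarrow> a = b"
  by (simp add: coeff_inject[symmetric] fun_eq_iff)

setup_lifting type_definition_novikov

lift_definition qpow :: "real \<Rightarrow> novikov" is "\<lambda>d x. if x = d \<and> 0 \<le> d then 1 else 0"
  unfolding novikov_ex_iff locally_finite_def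
  by (auto intro: finite_subset[of _ "{d}" for d])

instantiation novikov :: comm_ring_1
begin

lift_definition zero_novikov :: novikov is "\<lambda>x. 0"
  unfolding novikov_ex_iff locally_finite_def by simp

lift_definition one_novikov :: novikov is "\<lambda>x. if x = 0 then 1 else 0"
  unfolding novikov_ex_iff locally_finite_def
  by (auto intro: finite_subset[of _ "{0}"])

lift_definition plus_novikov :: "novikov \<Rightarrow> novikov \<Rightarrow> novikov" is "\<lambda>a b x. a x + b x"
  unfolding novikov_ex_iff locally_finite_def
proof safe
  fix a b :: "real \<Rightarrow> complex" and E :: real
  assume "\<forall>E. finite {x. a x \<noteq> 0 \<and> x \<le> E}" "\<forall>E. finite {x. b x \<noteq> 0 \<and> x \<le> E}"
  then have "finite ({x. a x \<noteq> 0 \<and> x \<le> E} \<union> {x. b x \<noteq> 0 \<and> x \<le> E})" by simp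
  then show "finite {x. a x + b x \<noteq> 0 \<and> x \<le> E}" by (rule rev_finite_subset) auto
qed simp

lift_definition uminus_novikov :: "novikov \<Rightarrow> novikov" is "\<lambda>a x. - a x"
  unfolding novikov_ex_iff locally_finite_def by simp

definition minus_novikov :: "novikov \<Rightarrow> novikov \<Rightarrow> novikov" where
  "a - b = a + - b" for a b :: novikov

lift_definition times_novikov :: "novikov \<Rightarrow> novikov \<Rightarrow> novikov" is
  "\<lambda>a b x. \<Sum>y | a y \<noteq> 0 \<and> b (x - y) \<noteq> 0. a y * b (x - y)"
  unfolding novikov_ex_iff
proof -
  fix a b :: "real \<Rightarrow> complex"
  assume a: "locally_finite a" and b: "locally_finite b"
  let ?p = "\<lambda>x. \<Sum>y | a y \<noteq> 0 \<and> b (x - y) \<noteq> 0. a y * b (x - y)"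
  have nz: "\<exists>y z. a y \<noteq> 0 \<and> b z \<noteq> 0 \<and> 0 \<le> y \<and> 0 \<le> z \<and> x = y + z" if "?p x \<noteq> 0" for x
  proof -
    have "\<exists>y. a y \<noteq> 0 \<and> b (x - y) \<noteq> 0"
    proof (rule ccontr)
      assume "\<not> ?thesis"
      then have "{y. a y \<noteq> 0 \<and> b (x - y) \<noteq> 0} = {}" by blast
      then show False using that by (simp only: sum.empty)
    qed
    then obtain y where y: "a y \<noteq> 0" "b (x - y) \<noteq> 0" by blast
    have "\<not> y < 0" "\<not> x - y < 0"
      using a b y unfolding locally_finite_def by blast+
    with y show ?thesis by (intro exI[of _ y] exI[of _ "x - y"]) simp
  qed
  have "?p x = 0" if "x < 0" for x
  proof (rule ccontr)
    assume "?p x \<noteq> 0"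
    from nz[OF this] obtain y z where "0 \<le> y" "0 \<le> z" "x = y + z" by blast
    then show False using that by simp
  qed
  moreover have "finite {x. ?p x \<noteq> 0 \<and> x \<le> E}" for E
  proof (rule finite_subset)
    show "{x. ?p x \<noteq> 0 \<and> x \<le> E} \<subseteq>
        (\<lambda>(y, z). y + z) ` ({y. a y \<noteq> 0 \<and> y \<le> E} \<times> {z. b z \<noteq> 0 \<and> z \<le> E})"
    proof
      fix x assume "x \<in> {x. ?p x \<noteq> 0 \<and> x \<le> E}"
      then have "?p x \<noteq> 0" "x \<le> E" by blast+
      from nz[OF this(1)] obtain y z where "a y \<noteq> 0" "b z \<noteq> 0" "0 \<le> y" "0 \<le> z" "x = y + z"
        by blast
      then show "x \<in> (\<lambda>(y, z). y + z) ` ({y. a y \<noteq> 0 \<and> y \<le> E} \<times> {z. b z \<noteq> 0 \<and> z \<le> E})"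
        using \<open>x \<le> E\<close> by (intro image_eqI[of _ _ "(y, z)"]) auto
    qed
    show "finite ((\<lambda>(y, z). y + z) ` ({y. a y \<noteq> 0 \<and> y \<le> E} \<times> {z. b z \<noteq> 0 \<and> z \<le> E}))"
      using a b unfolding locally_finite_def by blast
  qed
  ultimately show "locally_finite ?p" by (simp add: locally_finite_def)
qed

lemma coeff_times_pairs:
  assumes "finite A" "finite B"
    and "\<And>y. coeff a y \<noteq> 0 \<Longrightarrow> y \<le> x \<Longrightarrow> y \<in> A"
    and "\<And>z. coeff b z \<noteq> 0 \<Longrightarrow> z \<le> x \<Longrightarrow> z \<in> B"
  shows "coeff (a * b) x =
    (\<Sum>y\<in>A. \<Sum>z\<in>B. if y + z = x then coeff a y * coeff b z else 0)"
proof -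
  have supp: "y \<in> A \<and> x - y \<in> B" if "coeff a y \<noteq> 0" "coeff b (x - y) \<noteq> 0" for y
  proof -
    have "0 \<le> y" "0 \<le> x - y" using that coeff_neg not_less by blast+
    then show ?thesis using assms(3,4) that by simp
  qed
  have inner: "(\<Sum>z\<in>B. if y + z = x then coeff a y * coeff b z else 0) =
      (if x - y \<in> B then coeff a y * coeff b (x - y) else 0)" for y
  proof -
    have "(\<Sum>z\<in>B. if y + z = x then coeff a y * coeff b z else 0) =
        (\<Sum>z\<in>B. if z = x - y then coeff a y * coeff b z else 0)"
      by (intro sum.cong) auto
    then show ?thesis using assms(2) by (simp add: sum.delta)
  qed
  have "coeff (a * b) x = (\<Sum>y | coeff a y \<noteq> 0 \<and> coeff b (x - y) \<noteq> 0. coeff a y * coeff b (x - y))"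
    by (simp add: times_novikov.rep_eq)
  also have "\<dots> = (\<Sum>y\<in>A. if x - y \<in> B then coeff a y * coeff b (x - y) else 0)"
    by (rule sum.mono_neutral_cong_left) (use assms(1) supp in auto)
  finally show ?thesis by (simp only: inner)
qed

instance
proof
  fix a b c :: novikov
  show "a + b + c = a + (b + c)" by transfer (simp add: add.assoc)
  show "a + b = b + a" by transfer (simp add: add.commute)
  show "0 + a = a" by transfer simp
  show "- a + a = 0" by transfer simp
  show "a - b = a + - b" by (rule minus_novikov_def)
  show "(0::novikov) \<noteq> 1" by transfer (auto simp: fun_eq_iff)
  define S where "S = (\<lambda>u x. {y. coeff u y \<noteq> 0 \<and> y \<le> x})"
  have fS: "finite (S u x)" for u x unfolding S_def by (rule finite_support)
  have S: "coeff u y \<noteq> 0 \<Longrightarrow> y \<le> x \<Longrightarrow> y \<in> S u x" for u x y unfolding S_def by simp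
  have comm: "u * v = v * u" for u v :: novikov
  proof (rule novikov_eqI)
    fix x
    show "coeff (u * v) x = coeff (v * u) x"
      by (subst coeff_times_pairs[OF fS fS S S], assumption+,
          subst coeff_times_pairs[OF fS fS S S], assumption+,
          subst sum.swap, intro sum.cong refl, simp add: add.commute mult.commute)
  qed
  show "a * b = b * a" by (rule comm)
  show "1 * a = a"
  proof (rule novikov_eqI)
    fix x
    have "coeff (1 * a) x = (\<Sum>y | coeff 1 y \<noteq> 0 \<and> coeff a (x - y) \<noteq> 0. coeff 1 y * coeff a (x - y))"
      by (simp add: times_novikov.rep_eq)
    also have "\<dots> = (\<Sum>y\<in>{0}. coeff 1 y * coeff a (x - y))"
      by (rule sum.mono_neutral_left) (auto simp: one_novikov.rep_eq)
    finally show "coeff (1 * a) x = coeff a x" by (simp add: one_novikov.rep_eq)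
  qed
  show "(a + b) * c = a * c + b * c"
  proof (rule novikov_eqI)
    fix x
    let ?A = "S a x \<union> S b x"
    have 1: "coeff (a * c) x = (\<Sum>y\<in>?A. \<Sum>z\<in>S c x. if y + z = x then coeff a y * coeff c z else 0)"
      by (rule coeff_times_pairs) (simp_all add: fS, simp_all add: S_def)
    have 2: "coeff (b * c) x = (\<Sum>y\<in>?A. \<Sum>z\<in>S c x. if y + z = x then coeff b y * coeff c z else 0)"
      by (rule coeff_times_pairs) (simp_all add: fS, simp_all add: S_def)
    have 3: "coeff ((a + b) * c) x =
        (\<Sum>y\<in>?A. \<Sum>z\<in>S c x. if y + z = x then coeff (a + b) y * coeff c z else 0)"
      by (rule coeff_times_pairs) (simp_all add: fS, auto simp: S_def plus_novikov.rep_eq)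
    show "coeff ((a + b) * c) x = coeff (a * c + b * c) x"
      unfolding plus_novikov.rep_eq[of "a * c"] 1 2 3 sum.distrib[symmetric]
      by (intro sum.cong refl) (simp add: plus_novikov.rep_eq distrib_right)
  qed
  show "a * b * c = a * (b * c)"
  proof -
    have triple: "coeff (u * v * w) x = (\<Sum>y\<in>S u x. \<Sum>z\<in>S v x. \<Sum>t\<in>S w x.
        if y + z + t = x then coeff u y * coeff v z * coeff w t else 0)" for u v w x
    proof -
      define P where "P = (\<lambda>(y, z). y + z) ` (S u x \<times> S v x)"
      have fP: "finite P" unfolding P_def by (simp add: fS)
      have uv: "coeff (u * v) p =
          (\<Sum>y\<in>S u x. \<Sum>z\<in>S v x. if y + z = p then coeff u y * coeff v z else 0)" if "p \<le> x" for p
        by (rule coeff_times_pairs[OF fS fS]) (use that in \<open>auto simp: S_def\<close>)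
      have inP: "p \<in> P" if nz: "coeff (u * v) p \<noteq> 0" and le: "p \<le> x" for p
      proof (rule ccontr)
        assume "p \<notin> P"
        then have "y + z \<noteq> p" if "y \<in> S u x" "z \<in> S v x" for y z
          using that by (auto simp: P_def)
        then have "coeff (u * v) p = 0"
          unfolding uv[OF le] by (intro sum.neutral ballI) auto
        then show False using nz by simp
      qed
      have t0: "0 \<le> t" if "t \<in> S w x" for t
        using that coeff_neg not_less unfolding S_def by blast
      have "coeff (u * v * w) x =
          (\<Sum>p\<in>P. \<Sum>t\<in>S w x. if p + t = x then coeff (u * v) p * coeff w t else 0)"
        by (rule coeff_times_pairs[OF fP fS inP S])
      also have "\<dots> = (\<Sum>p\<in>P. \<Sum>t\<in>S w x. \<Sum>y\<in>S u x. \<Sum>z\<in>S v x.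
          if y + z = p \<and> p + t = x then coeff u y * coeff v z * coeff w t else 0)"
      proof (intro sum.cong refl)
        fix p t assume "p \<in> P" and t: "t \<in> S w x"
        show "(if p + t = x then coeff (u * v) p * coeff w t else 0) =
          (\<Sum>y\<in>S u x. \<Sum>z\<in>S v x.
            if y + z = p \<and> p + t = x then coeff u y * coeff v z * coeff w t else 0)"
        proof (cases "p + t = x")
          case True
          then have "p \<le> x" using t0[OF t] by simp
          then show ?thesis using True
            by (simp add: uv sum_distrib_right if_distrib[of "\<lambda>r. r * _"] cong: if_cong)
        qed simp
      qed
      also have "\<dots> = (\<Sum>t\<in>S w x. \<Sum>y\<in>S u x. \<Sum>z\<in>S v x. \<Sum>p\<in>P.
          if y + z = p \<and> p + t = x then coeff u y * coeff v z * coeff w t else 0)"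
        apply (rule trans[OF sum.swap])
        apply (rule sum.cong[OF refl])
        apply (rule trans[OF sum.swap])
        apply (rule sum.cong[OF refl])
        apply (rule sum.swap)
        done
      also have "\<dots> = (\<Sum>t\<in>S w x. \<Sum>y\<in>S u x. \<Sum>z\<in>S v x.
          if y + z + t = x then coeff u y * coeff v z * coeff w t else 0)"
      proof (intro sum.cong refl)
        fix t y z assume "y \<in> S u x" "z \<in> S v x"
        then have mem: "y + z \<in> P" by (auto simp: P_def)
        have "(\<Sum>p\<in>P. if y + z = p \<and> p + t = x then coeff u y * coeff v z * coeff w t else 0) =
          (\<Sum>p\<in>P. if y + z = p then (if y + z + t = x then coeff u y * coeff v z * coeff w t else 0) else 0)"
          by (intro sum.cong) auto
        also have "\<dots> = (if y + z + t = x then coeff u y * coeff v z * coeff w t else 0)"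
          using mem fP by (simp add: sum.delta')
        finally show "(\<Sum>p\<in>P. if y + z = p \<and> p + t = x then coeff u y * coeff v z * coeff w t else 0) =
          (if y + z + t = x then coeff u y * coeff v z * coeff w t else 0)" .
      qed
      also have "\<dots> = (\<Sum>y\<in>S u x. \<Sum>z\<in>S v x. \<Sum>t\<in>S w x.
        if y + z + t = x then coeff u y * coeff v z * coeff w t else 0)"
        apply (rule trans[OF sum.swap])
        apply (rule sum.cong[OF refl])
        apply (rule sum.swap)
        done
      finally show ?thesis .
    qed
    have "a * b * c = b * c * a"
    proof (rule novikov_eqI)
      fix x
      have "coeff (b * c * a) x = (\<Sum>y\<in>S b x. \<Sum>t\<in>S a x. \<Sum>z\<in>S c x.
          if y + z + t = x then coeff b y * coeff c z * coeff a t else 0)"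
        unfolding triple by (intro sum.cong refl sum.swap)
      also have "\<dots> = (\<Sum>t\<in>S a x. \<Sum>y\<in>S b x. \<Sum>z\<in>S c x.
          if y + z + t = x then coeff b y * coeff c z * coeff a t else 0)"
        by (rule sum.swap)
      also have "\<dots> = coeff (a * b * c) x"
        unfolding triple by (intro sum.cong refl) (simp add: ac_simps)
      finally show "coeff (a * b * c) x = coeff (b * c * a) x" ..
    qed
    then show ?thesis by (simp add: comm)
  qed
qed

end

lemma coeff_zero [simp]: "coeff 0 x = 0"
  by (simp add: zero_novikov.rep_eq)

lemma coeff_add: "coeff (a + b) x = coeff a x + coeff b x"
  by (simp add: plus_novikov.rep_eq)

lemma coeff_diff: "coeff (a - b) x = coeff a x - coeff b x"
  unfolding minus_novikov_def plus_novikov.rep_eq uminus_novikov.rep_eq by simp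

lemma coeff_one: "coeff 1 x = (if x = 0 then 1 else 0)"
  by (simp add: one_novikov.rep_eq)

lemma coeff_sum: "coeff (\<Sum>i\<in>I. f i) x = (\<Sum>i\<in>I. coeff (f i) x)"
  by (induction I rule: infinite_finite_induct) (simp_all add: coeff_add)

lemma coeff_of_nat_mult: "coeff (of_nat k * a) x = of_nat k * coeff a x"
  by (induction k) (simp_all add: coeff_add distrib_right)

lemma coeff_times_nz:
  assumes "coeff (a * b) x \<noteq> 0"
  obtains y z where "coeff a y \<noteq> 0" "coeff b z \<noteq> 0" "x = y + z"
proof -
  have nz: "(\<Sum>y | coeff a y \<noteq> 0 \<and> coeff b (x - y) \<noteq> 0. coeff a y * coeff b (x - y)) \<noteq> 0"
    using assms by (simp add: times_novikov.rep_eq)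
  have "\<exists>y. coeff a y \<noteq> 0 \<and> coeff b (x - y) \<noteq> 0"
  proof (rule ccontr)
    assume "\<not> ?thesis"
    then have "{y. coeff a y \<noteq> 0 \<and> coeff b (x - y) \<noteq> 0} = {}" by blast
    then show False using nz by (simp only: sum.empty)
  qed
  then obtain y where "coeff a y \<noteq> 0" "coeff b (x - y) \<noteq> 0" by blast
  then show ?thesis using that[of y "x - y"] by simp
qed


section \<open>The exponential\<close>

definition supp_upto :: "novikov \<Rightarrow> real \<Rightarrow> real set" where
  "supp_upto a E = {x. coeff a x \<noteq> 0 \<and> x \<le> E}"

definition abs_upto :: "novikov \<Rightarrow> real \<Rightarrow> real" where
  "abs_upto a E = (\<Sum>x\<in>supp_upto a E. norm (coeff a x))"

lemma finite_supp_upto [simp]: "finite (supp_upto a E)"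
  unfolding supp_upto_def by (rule finite_support)

lemma abs_upto_nonneg: "0 \<le> abs_upto a E"
  unfolding abs_upto_def by (simp add: sum_nonneg)

lemma norm_coeff_le_abs_upto: "x \<le> E \<Longrightarrow> norm (coeff a x) \<le> abs_upto a E"
proof (cases "coeff a x = 0")
  case False
  assume "x \<le> E"
  with False have "x \<in> supp_upto a E" by (simp add: supp_upto_def)
  then show ?thesis unfolding abs_upto_def by (intro member_le_sum) auto
qed (simp add: abs_upto_nonneg)

lemma abs_upto_mult: "abs_upto (a * b) E \<le> abs_upto a E * abs_upto b E"
proof -
  let ?A = "supp_upto a E" and ?B = "supp_upto b E" and ?C = "supp_upto (a * b) E"
  have "norm (coeff (a * b) x) \<le>
      (\<Sum>y\<in>?A. \<Sum>z\<in>?B. if y + z = x then norm (coeff a y) * norm (coeff b z) else 0)"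
    if "x \<in> ?C" for x
  proof -
    have "coeff (a * b) x = (\<Sum>y\<in>?A. \<Sum>z\<in>?B. if y + z = x then coeff a y * coeff b z else 0)"
      by (rule coeff_times_pairs) (use that in \<open>auto simp: supp_upto_def finite_support\<close>)
    also have "norm \<dots> \<le> (\<Sum>y\<in>?A. \<Sum>z\<in>?B. norm (if y + z = x then coeff a y * coeff b z else 0))"
      by (intro order_trans[OF norm_sum] sum_mono norm_sum)
    also have "\<dots> = (\<Sum>y\<in>?A. \<Sum>z\<in>?B. if y + z = x then norm (coeff a y) * norm (coeff b z) else 0)"
      by (intro sum.cong refl) (simp add: norm_mult)
    finally show ?thesis .
  qed
  then have "abs_upto (a * b) E \<le> (\<Sum>x\<in>?C. \<Sum>y\<in>?A. \<Sum>z\<in>?B.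
      if y + z = x then norm (coeff a y) * norm (coeff b z) else 0)"
    unfolding abs_upto_def by (rule sum_mono)
  also have "\<dots> = (\<Sum>y\<in>?A. \<Sum>z\<in>?B. \<Sum>x\<in>?C.
      if y + z = x then norm (coeff a y) * norm (coeff b z) else 0)"
    by (rule trans[OF sum.swap], rule sum.cong[OF refl], rule sum.swap)
  also have "\<dots> \<le> (\<Sum>y\<in>?A. \<Sum>z\<in>?B. norm (coeff a y) * norm (coeff b z))"
    by (intro sum_mono) (simp add: sum.delta')
  also have "\<dots> = abs_upto a E * abs_upto b E"
    by (simp add: abs_upto_def sum_product)
  finally show ?thesis .
qed

lemma abs_upto_power: "abs_upto (a ^ n) E \<le> (1 + abs_upto 1 E) * abs_upto a E ^ n"
proof (induction n)
  case (Suc n)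
  have "abs_upto (a ^ Suc n) E \<le> abs_upto a E * abs_upto (a ^ n) E"
    using abs_upto_mult[of a "a ^ n"] by simp
  also have "\<dots> \<le> abs_upto a E * ((1 + abs_upto 1 E) * abs_upto a E ^ n)"
    by (intro mult_left_mono Suc abs_upto_nonneg)
  finally show ?case by (simp add: ac_simps)
qed simp

lemma summable_norm_exp_coeff: "summable (\<lambda>n. norm (coeff (a ^ n) x / fact n))"
proof (rule summable_comparison_test')
  show "summable (\<lambda>n. (1 + abs_upto 1 x) * (inverse (fact n) * abs_upto a x ^ n))"
    by (intro summable_mult summable_exp)
  fix n
  have "norm (coeff (a ^ n) x) \<le> (1 + abs_upto 1 x) * abs_upto a x ^ n"
    using norm_coeff_le_abs_upto[of x x "a ^ n"] abs_upto_power[of a n x] by linarith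
  then show "norm (norm (coeff (a ^ n) x / fact n))
      \<le> (1 + abs_upto 1 x) * (inverse (fact n) * abs_upto a x ^ n)"
    by (simp add: norm_divide divide_simps mult.commute)
qed

lemma summable_exp_coeff: "summable (\<lambda>n. coeff (a ^ n) x / fact n)"
  by (rule summable_norm_cancel[OF summable_norm_exp_coeff])

lemma finite_power_support: "finite {x. (\<exists>n. coeff (a ^ n) x \<noteq> 0) \<and> x \<le> E}"
proof -
  define T where "T = {x. \<exists>n. coeff (a ^ n) x \<noteq> 0}"
  define S where "S = {x. coeff a x \<noteq> 0 \<and> x \<noteq> 0}"
  have Spos: "0 < x" if "x \<in> S" for x
  proof (rule ccontr)
    assume "\<not> 0 < x"
    then have "x < 0" using that by (simp add: S_def)
    then show False using that coeff_neg[of x a] by (simp add: S_def)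
  qed
  have finS: "finite {x \<in> S. x \<le> E}" for E
    by (rule finite_subset[OF _ finite_support[of a E]]) (auto simp: S_def)
  obtain m where m: "0 < m" "\<And>x. x \<in> S \<Longrightarrow> m \<le> x"
  proof -
    define M where "M = Min (insert 1 {x \<in> S. x \<le> 1})"
    have "0 < M" unfolding M_def using finS[of 1] Spos by simp
    moreover have "M \<le> x" if "x \<in> S" for x
    proof (cases "x \<le> 1")
      case True
      then show ?thesis unfolding M_def using finS[of 1] that by simp
    next
      case False
      moreover have "M \<le> 1" unfolding M_def using finS[of 1] by simp
      ultimately show ?thesis by simp
    qed
    ultimately show ?thesis using that by blast
  qed
  have step: "x = 0 \<or> (\<exists>s\<in>S. \<exists>y\<in>T. x = s + y)" if "coeff (a ^ n) x \<noteq> 0" for n x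
    using that
  proof (induction n)
    case 0
    then show ?case by (auto simp: coeff_one split: if_splits)
  next
    case (Suc n)
    then obtain y z where yz: "coeff a y \<noteq> 0" "coeff (a ^ n) z \<noteq> 0" "x = y + z"
      using coeff_times_nz[of a "a ^ n" x] by auto
    show ?case
    proof (cases "y = 0")
      case True
      then show ?thesis using Suc.IH yz by simp
    next
      case False
      then have "y \<in> S" "z \<in> T" using yz by (auto simp: S_def T_def)
      then show ?thesis using yz by blast
    qed
  qed
  have fin: "finite {x \<in> T. x \<le> real k * m}" for k
  proof (induction k)
    case 0
    have "{x \<in> T. x \<le> real 0 * m} \<subseteq> {0}"
    proof
      fix x assume x: "x \<in> {x \<in> T. x \<le> real 0 * m}"
      then have "\<not> x < 0" using coeff_neg unfolding T_def by blast
      then show "x \<in> {0}" using x by simp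
    qed
    then show ?case using finite_subset by blast
  next
    case (Suc k)
    let ?P = "{x \<in> S. x \<le> real (Suc k) * m}" and ?Q = "{x \<in> T. x \<le> real k * m}"
    have "{x \<in> T. x \<le> real (Suc k) * m} \<subseteq> insert 0 ((\<lambda>(s, y). s + y) ` (?P \<times> ?Q))"
    proof
      fix x assume x: "x \<in> {x \<in> T. x \<le> real (Suc k) * m}"
      then obtain n where "coeff (a ^ n) x \<noteq> 0" by (auto simp: T_def)
      from step[OF this] show "x \<in> insert 0 ((\<lambda>(s, y). s + y) ` (?P \<times> ?Q))"
      proof
        assume "\<exists>s\<in>S. \<exists>y\<in>T. x = s + y"
        then obtain s y where sy: "s \<in> S" "y \<in> T" "x = s + y" by blast
        have "m \<le> s" using m sy by blast
        moreover have "0 \<le> y"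
          using sy(2) coeff_neg not_less unfolding T_def by blast
        ultimately have "s \<in> ?P" "y \<in> ?Q" using x sy by (auto simp: distrib_right)
        then show ?thesis using sy(3) by (intro insertI2 image_eqI[of _ _ "(s, y)"]) auto
      qed simp
    qed
    moreover have "finite (insert 0 ((\<lambda>(s, y). s + y) ` (?P \<times> ?Q)))"
      using Suc.IH finS by simp
    ultimately show ?case by (rule finite_subset)
  qed
  obtain k :: nat where "E \<le> real k * m"
    using reals_Archimedean3[OF m(1)] less_imp_le by blast
  then have "{x. (\<exists>n. coeff (a ^ n) x \<noteq> 0) \<and> x \<le> E} \<subseteq> {x \<in> T. x \<le> real k * m}"
    unfolding T_def by auto
  then show ?thesis using fin finite_subset by blast
qed

text \<open>
  The exponential is the power series \<open>\<Sum>n. b^n / n!\<close>, each coefficient of which is an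
  absolutely convergent series of complex numbers; in particular, a constant
  \<open>c\<close> has exponential \<open>e\<^sup>c\<close>.
\<close>

definition nexp :: "novikov \<Rightarrow> novikov" where
  "nexp b = Abs_novikov (\<lambda>x. \<Sum>n. coeff (b ^ n) x / fact n)"

lemma coeff_nexp: "coeff (nexp b) x = (\<Sum>n. coeff (b ^ n) x / fact n)"
proof -
  have nz: "\<exists>n. coeff (b ^ n) x \<noteq> 0" if "(\<Sum>n. coeff (b ^ n) x / fact n) \<noteq> 0" for x
  proof (rule ccontr)
    assume "\<not> (\<exists>n. coeff (b ^ n) x \<noteq> 0)"
    then show False using that by simp
  qed
  have "locally_finite (\<lambda>x. \<Sum>n. coeff (b ^ n) x / fact n)"
    unfolding locally_finite_def
  proof safe
    fix E
    show "finite {x. (\<Sum>n. coeff (b ^ n) x / fact n) \<noteq> 0 \<and> x \<le> E}"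
      by (rule finite_subset[OF _ finite_power_support[of b E]]) (use nz in blast)
  qed (simp add: coeff_neg)
  then have "(\<lambda>x. \<Sum>n. coeff (b ^ n) x / fact n) \<in>
      {sum_coeff c d |c d. (\<forall>n. 0 \<le> d n) \<and> filterlim d at_top sequentially}"
    by (simp only: novikov_set_iff)
  then show ?thesis unfolding nexp_def by (simp only: Abs_novikov_inverse)
qed

lemma nexp_add: "nexp (a + b) = nexp a * nexp b"
proof (rule novikov_eqI)
  fix x
  let ?A = "{y. (\<exists>n. coeff (a ^ n) y \<noteq> 0) \<and> y \<le> x}"
  let ?B = "{y. (\<exists>n. coeff (b ^ n) y \<noteq> 0) \<and> y \<le> x}"
  let ?t = "\<lambda>n. \<Sum>y\<in>?A. \<Sum>z\<in>?B. if y + z = x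
      then (\<Sum>i\<le>n. (coeff (a ^ i) y / fact i) * (coeff (b ^ (n - i)) z / fact (n - i))) else 0"
  have nz: "\<exists>n. coeff (u ^ n) y \<noteq> 0" if "coeff (nexp u) y \<noteq> 0" for u y
  proof (rule ccontr)
    assume "\<not> (\<exists>n. coeff (u ^ n) y \<noteq> 0)"
    then show False using that by (simp add: coeff_nexp)
  qed
  have "?t sums (\<Sum>y\<in>?A. \<Sum>z\<in>?B. if y + z = x then coeff (nexp a) y * coeff (nexp b) z else 0)"
  proof (intro sums_sum)
    fix y z
    have "(\<lambda>n. \<Sum>i\<le>n. (coeff (a ^ i) y / fact i) * (coeff (b ^ (n - i)) z / fact (n - i)))
        sums (coeff (nexp a) y * coeff (nexp b) z)"
      unfolding coeff_nexp by (intro Cauchy_product_sums summable_norm_exp_coeff)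
    then show "(\<lambda>n. if y + z = x
        then (\<Sum>i\<le>n. (coeff (a ^ i) y / fact i) * (coeff (b ^ (n - i)) z / fact (n - i))) else 0)
        sums (if y + z = x then coeff (nexp a) y * coeff (nexp b) z else 0)"
      by simp
  qed
  also have "(\<Sum>y\<in>?A. \<Sum>z\<in>?B. if y + z = x then coeff (nexp a) y * coeff (nexp b) z else 0)
      = coeff (nexp a * nexp b) x"
    by (rule coeff_times_pairs[symmetric]) (use finite_power_support nz in auto)
  also have "?t = (\<lambda>n. coeff ((a + b) ^ n) x / fact n)"
  proof
    fix n
    have "coeff ((a + b) ^ n) x / fact n =
        (\<Sum>i\<le>n. of_nat (n choose i) * coeff (a ^ i * b ^ (n - i)) x / fact n)"
      by (simp add: binomial_ring coeff_sum sum_divide_distrib coeff_of_nat_mult mult.assoc)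
    also have "\<dots> = (\<Sum>i\<le>n. coeff (a ^ i * b ^ (n - i)) x / (fact i * fact (n - i)))"
      by (intro sum.cong refl) (simp add: binomial_fact field_simps)
    also have "\<dots> = (\<Sum>i\<le>n. \<Sum>y\<in>?A. \<Sum>z\<in>?B. if y + z = x
        then (coeff (a ^ i) y / fact i) * (coeff (b ^ (n - i)) z / fact (n - i)) else 0)"
    proof (intro sum.cong refl)
      fix i
      have "coeff (a ^ i * b ^ (n - i)) x =
          (\<Sum>y\<in>?A. \<Sum>z\<in>?B. if y + z = x then coeff (a ^ i) y * coeff (b ^ (n - i)) z else 0)"
        by (rule coeff_times_pairs) (use finite_power_support in auto)
      then show "coeff (a ^ i * b ^ (n - i)) x / (fact i * fact (n - i)) =
          (\<Sum>y\<in>?A. \<Sum>z\<in>?B. if y + z = x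
            then (coeff (a ^ i) y / fact i) * (coeff (b ^ (n - i)) z / fact (n - i)) else 0)"
        by (simp add: sum_divide_distrib if_distrib[of "\<lambda>r. r / _"] cong: if_cong)
    qed
    also have "\<dots> = (\<Sum>y\<in>?A. \<Sum>z\<in>?B. \<Sum>i\<le>n. if y + z = x
        then (coeff (a ^ i) y / fact i) * (coeff (b ^ (n - i)) z / fact (n - i)) else 0)"
      by (rule trans[OF sum.swap], rule sum.cong[OF refl], rule sum.swap)
    also have "\<dots> = ?t n"
      by (intro sum.cong refl) simp
    finally show "?t n = coeff ((a + b) ^ n) x / fact n" ..
  qed
  finally show "coeff (nexp (a + b)) x = coeff (nexp a * nexp b) x"
    by (simp add: coeff_nexp sums_iff)
qed


section \<open>Differentiation\<close>

text \<open>
  The non-Archimedean norm \<open>exp (- val a)\<close>, where \<open>val a\<close> is the least exponent occurring in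
  \<open>a\<close>. It induces the \<open>q\<close>-adic topology, with respect to which derivatives are taken; since
  elements of positive valuation have no inverse in the ring, the usual limit of difference
  quotients is written as a first-order approximation. Such a derivative is unique and, on
  exponentials, agrees with the formal one; see \<open>has_nov_derivative_unique\<close> and
  \<open>nexp_has_nov_derivative\<close>.
\<close>

definition nov_norm :: "novikov \<Rightarrow> real" where
  "nov_norm a = (if a = 0 then 0 else exp (- Inf {x. coeff a x \<noteq> 0}))"

definition has_nov_derivative :: "(novikov \<Rightarrow> novikov) \<Rightarrow> novikov \<Rightarrow> novikov \<Rightarrow> bool" where
  "has_nov_derivative F D b \<longleftrightarrow>
     (\<forall>e>0. \<exists>d>0. \<forall>h. nov_norm h < d \<longrightarrow>
        nov_norm (F (b + h) - F b - D * h) \<le> e * nov_norm h)"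

lemma nov_norm_le_iff: "nov_norm a \<le> exp (- v) \<longleftrightarrow> (\<forall>x<v. coeff a x = 0)"
proof (cases "a = 0")
  case False
  let ?S = "{x. coeff a x \<noteq> 0}"
  have ne: "?S \<noteq> {}" using False novikov_eqI[of a 0] by auto
  have bdd: "bdd_below ?S"
    by (rule bdd_belowI[of _ 0]) (use coeff_neg not_less in blast)
  have "nov_norm a \<le> exp (- v) \<longleftrightarrow> v \<le> Inf ?S" using False by (simp add: nov_norm_def)
  also have "\<dots> \<longleftrightarrow> (\<forall>x\<in>?S. v \<le> x)" by (rule le_cInf_iff[OF ne bdd])
  also have "\<dots> \<longleftrightarrow> (\<forall>x<v. coeff a x = 0)" by (simp add: Ball_def) (meson not_less)
  finally show ?thesis .
qed (simp add: nov_norm_def)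

lemma coeff_times_qpow: "0 \<le> d \<Longrightarrow> coeff (a * qpow d) x = coeff a (x - d)"
proof -
  assume d: "0 \<le> d"
  have "coeff (a * qpow d) x =
      (\<Sum>y | coeff a y \<noteq> 0 \<and> coeff (qpow d) (x - y) \<noteq> 0. coeff a y * coeff (qpow d) (x - y))"
    by (simp add: times_novikov.rep_eq)
  also have "\<dots> = (\<Sum>y\<in>{x - d}. coeff a y * coeff (qpow d) (x - y))"
    by (rule sum.mono_neutral_left) (auto simp: qpow.rep_eq d)
  finally show ?thesis using d by (simp add: qpow.rep_eq)
qed

lemma coeff_times_eq_0:
  assumes "\<And>y. y < v \<Longrightarrow> coeff a y = 0" "\<And>y. y < w \<Longrightarrow> coeff b y = 0" "x < v + w"
  shows "coeff (a * b) x = 0"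
proof (rule ccontr)
  assume "coeff (a * b) x \<noteq> 0"
  then obtain y z where "coeff a y \<noteq> 0" "coeff b z \<noteq> 0" "x = y + z" by (rule coeff_times_nz)
  then have "\<not> y < v" "\<not> z < w" "x = y + z" using assms(1,2) by blast+
  then show False using assms(3) by linarith
qed

lemma has_nov_derivative_unique:
  assumes "has_nov_derivative F D b" "has_nov_derivative F D' b"
  shows "D = D'"
proof (rule novikov_eqI, rule ccontr)
  fix x assume ne: "coeff D x \<noteq> coeff D' x"
  define e where "e = exp (- (x + 1))"
  have "0 < e" by (simp add: e_def)
  obtain d where d: "0 < d"
    and D: "\<And>h. nov_norm h < d \<Longrightarrow> nov_norm (F (b + h) - F b - D * h) \<le> e * nov_norm h"
    using assms(1)[unfolded has_nov_derivative_def, rule_format, OF \<open>0 < e\<close>] by auto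
  obtain d' where d': "0 < d'"
    and D': "\<And>h. nov_norm h < d' \<Longrightarrow> nov_norm (F (b + h) - F b - D' * h) \<le> e * nov_norm h"
    using assms(2)[unfolded has_nov_derivative_def, rule_format, OF \<open>0 < e\<close>] by auto
  define N where "N = max 0 (- ln (min d d') + 1)"
  have N: "0 \<le> N" "exp (- N) < min d d'"
  proof -
    have "exp (- N) \<le> exp (ln (min d d') - 1)" by (simp add: N_def)
    also have "\<dots> < exp (ln (min d d'))" by simp
    finally show "exp (- N) < min d d'" using d d' by simp
  qed (simp add: N_def)
  let ?h = "qpow N"
  have h: "nov_norm ?h \<le> exp (- N)" by (simp add: nov_norm_le_iff qpow.rep_eq)
  have "e * nov_norm ?h \<le> exp (- (x + 1 + N))"
    using mult_left_mono[OF h, of e] by (simp add: e_def exp_add[symmetric])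
  then have "nov_norm (F (b + ?h) - F b - D * ?h) \<le> exp (- (x + 1 + N))"
    "nov_norm (F (b + ?h) - F b - D' * ?h) \<le> exp (- (x + 1 + N))"
    using D[of ?h] D'[of ?h] h N by linarith+
  then have "coeff (F (b + ?h) - F b - D * ?h) (x + N) = 0"
    "coeff (F (b + ?h) - F b - D' * ?h) (x + N) = 0"
    unfolding nov_norm_le_iff by simp_all
  then have "coeff (D * ?h) (x + N) = coeff (D' * ?h) (x + N)"
    by (simp add: coeff_diff)
  then show False using ne N(1) by (simp add: coeff_times_qpow)
qed

lemma nexp_has_nov_derivative: "has_nov_derivative nexp (nexp b) b"
  unfolding has_nov_derivative_def
proof (intro allI impI)
  fix e :: real assume e: "0 < e"
  show "\<exists>d>0. \<forall>h. nov_norm h < d \<longrightarrow>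
      nov_norm (nexp (b + h) - nexp b - nexp b * h) \<le> e * nov_norm h"
  proof (intro exI conjI allI impI)
    show "0 < e" by (rule e)
    fix h assume h: "nov_norm h < e"
    have eq: "nexp (b + h) - nexp b - nexp b * h = nexp b * (nexp h - 1 - h)"
      by (simp add: nexp_add algebra_simps)
    show "nov_norm (nexp (b + h) - nexp b - nexp b * h) \<le> e * nov_norm h"
    proof (cases "h = 0")
      case True
      have "nexp 0 = 1"
      proof (rule novikov_eqI)
        fix x
        have "(\<lambda>n. coeff (0 ^ n) x / fact n) sums coeff 1 x"
          using sums_single[of 0 "\<lambda>_. coeff 1 x"]
          by (rule sums_cong[THEN iffD1, rotated]) (simp add: power_0_left)
        then show "coeff (nexp 0) x = coeff 1 x" by (simp add: coeff_nexp sums_iff)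
      qed
      then show ?thesis using True by (simp add: nov_norm_def)
    next
      case False
      define v where "v = Inf {x. coeff h x \<noteq> 0}"
      have nh: "nov_norm h = exp (- v)" using False by (simp add: nov_norm_def v_def)
      then have hv: "coeff h x = 0" if "x < v" for x
        using that nov_norm_le_iff[of h v] by simp
      have tail: "coeff (nexp h - 1 - h) x = 0" if x: "x < v + v" for x
      proof -
        have z: "coeff (h ^ n) x = 0" if "n \<notin> {..<2}" for n
        proof -
          have "coeff (h ^ 2 * h ^ (n - 2)) x = 0"
          proof (rule coeff_times_eq_0)
            show "coeff (h ^ 2) y = 0" if "y < v + v" for y
              unfolding power2_eq_square using hv hv that by (rule coeff_times_eq_0)
            show "coeff (h ^ (n - 2)) y = 0" if "y < 0" for y
              using that by (rule coeff_neg)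
          qed (use x in simp)
          moreover have "h ^ 2 * h ^ (n - 2) = h ^ n"
            using that by (simp only: power_add[symmetric]) (simp only: lessThan_iff not_less le_add_diff_inverse)
          ultimately show ?thesis by simp
        qed
        have "coeff (nexp h) x = (\<Sum>n<2. coeff (h ^ n) x / fact n)"
          unfolding coeff_nexp by (rule suminf_finite) (use z in auto)
        also have "\<dots> = coeff 1 x + coeff h x" by (simp add: numeral_2_eq_2)
        finally show ?thesis by (simp add: coeff_diff)
      qed
      have "nov_norm (nexp b * (nexp h - 1 - h)) \<le> exp (- (0 + (v + v)))"
        unfolding nov_norm_le_iff
      proof (intro allI impI)
        fix x assume "x < 0 + (v + v)"
        then show "coeff (nexp b * (nexp h - 1 - h)) x = 0"
          by (intro coeff_times_eq_0[OF coeff_neg tail])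
      qed
      also have "\<dots> = nov_norm h * nov_norm h" by (simp add: nh exp_add[symmetric])
      also have "\<dots> \<le> e * nov_norm h"
        using h by (intro mult_right_mono) (simp_all add: nh)
      finally show ?thesis by (simp only: eq)
    qed
  qed
qed

definition has_partial1 ::
    "(novikov \<times> novikov \<Rightarrow> novikov) \<Rightarrow> novikov \<Rightarrow> novikov \<times> novikov \<Rightarrow> bool" where
  "has_partial1 F D b \<longleftrightarrow> has_nov_derivative (\<lambda>x. F (x, snd b)) D (fst b)"

definition has_partial2 ::
    "(novikov \<times> novikov \<Rightarrow> novikov) \<Rightarrow> novikov \<Rightarrow> novikov \<times> novikov \<Rightarrow> bool" where
  "has_partial2 F D b \<longleftrightarrow> has_nov_derivative (\<lambda>x. F (fst b, x)) D (snd b)"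

definition critical_point ::
    "(novikov \<times> novikov \<Rightarrow> novikov) \<Rightarrow> novikov \<times> novikov \<Rightarrow> bool" where
  "critical_point F b \<longleftrightarrow> has_partial1 F 0 b \<and> has_partial2 F 0 b"


section \<open>The ellipsoid and its potential\<close>

definition ellipsoid :: "(complex \<times> complex) set" where
  "ellipsoid = {(z1, z2). (cmod z1)\<^sup>2 + (cmod z2)\<^sup>2 / 2 < 1}"

definition moment_map :: "complex \<times> complex \<Rightarrow> real \<times> real" where
  "moment_map = (\<lambda>(z1, z2). ((cmod z1)\<^sup>2, (cmod z2)\<^sup>2))"

lemma moment_image_ellipsoid:
  "moment_map ` ellipsoid = {(l1, l2). 0 \<le> l1 \<and> 0 \<le> l2 \<and> 2 * l1 + l2 < 2 \<and> l1 < 1}"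
proof
  show "moment_map ` ellipsoid \<subseteq> {(l1, l2). 0 \<le> l1 \<and> 0 \<le> l2 \<and> 2 * l1 + l2 < 2 \<and> l1 < 1}"
  proof
    fix p assume "p \<in> moment_map ` ellipsoid"
    then obtain z1 z2 where p: "p = ((cmod z1)\<^sup>2, (cmod z2)\<^sup>2)"
      and z: "(cmod z1)\<^sup>2 + (cmod z2)\<^sup>2 / 2 < 1"
      by (auto simp: moment_map_def ellipsoid_def)
    have "0 \<le> (cmod z1)\<^sup>2" "0 \<le> (cmod z2)\<^sup>2" by simp_all
    then have "2 * (cmod z1)\<^sup>2 + (cmod z2)\<^sup>2 < 2" "(cmod z1)\<^sup>2 < 1"
      using z by linarith+
    then show "p \<in> {(l1, l2). 0 \<le> l1 \<and> 0 \<le> l2 \<and> 2 * l1 + l2 < 2 \<and> l1 < 1}"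
      by (simp add: p)
  qed
  show "{(l1, l2). 0 \<le> l1 \<and> 0 \<le> l2 \<and> 2 * l1 + l2 < 2 \<and> l1 < 1} \<subseteq> moment_map ` ellipsoid"
  proof
    fix p :: "real \<times> real"
    assume "p \<in> {(l1, l2). 0 \<le> l1 \<and> 0 \<le> l2 \<and> 2 * l1 + l2 < 2 \<and> l1 < 1}"
    then obtain l1 l2 where p: "p = (l1, l2)" "0 \<le> l1" "0 \<le> l2" "2 * l1 + l2 < 2" by auto
    then have "(complex_of_real (sqrt l1), complex_of_real (sqrt l2)) \<in> ellipsoid"
      by (simp add: ellipsoid_def)
    moreover have "p = moment_map (complex_of_real (sqrt l1), complex_of_real (sqrt l2))"
      using p by (simp add: moment_map_def)
    ultimately show "p \<in> moment_map ` ellipsoid" by blast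
  qed
qed

text \<open>
  All exponents below are nonnegative for \<open>(l1, l2)\<close> in the moment polytope, \<open>\<epsilon>1 \<le> -2\<close> and
  \<open>\<epsilon>2 \<le> -1\<close>; outside this range, where the expression need not make sense,
  \<open>qpow\<close> of a negative number is 0.
\<close>

definition potential ::
    "real \<times> real \<Rightarrow> real \<times> real \<Rightarrow> novikov \<times> novikov \<Rightarrow> novikov \<times> novikov \<Rightarrow> novikov" where
  "potential = (\<lambda>(l1, l2) (\<epsilon>1, \<epsilon>2) (\<delta>1, \<delta>2) (b1, b2).
     qpow l1 * nexp b1 + qpow l2 * nexp b2
     + qpow (- 2 * l1 - l2 - \<epsilon>1) * nexp (- 2 * b1 - b2 - \<delta>1)
     + qpow (- l1 - \<epsilon>2) * nexp (- b1 - \<delta>2))"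

end

theory Submission
  imports Defs
begin

text \<open>
  Write \<open>A = - 2 \<lambda>1 - \<lambda>2 - \<epsilon>1\<close> and \<open>B = - \<lambda>1 - \<epsilon>2\<close> for the exponents of the last two terms of the
  potential, and \<open>U\<close>, \<open>V\<close> for their exponential factors. Since the derivative is unique and the
  usual rules hold, the critical points are the solutions of the two equations
  \<open>q^\<lambda>1 e^b1 = 2 q^A U + q^B V\<close> and \<open>q^\<lambda>2 e^b2 = q^A U\<close>
  (\<open>critical_point_potential_iff\<close>). Everything else is a comparison of lowest exponents, which
  works because an exponential is invertible and so has a nonzero constant term
  (\<open>coeff_nexp_0\<close>).

  Necessity (\<open>critical_point_imp\<close>): the second equation forces \<open>A = \<lambda>2\<close>, that is
  \<open>- \<epsilon>1 = 2 (\<lambda>1 + \<lambda>2)\<close>, whence \<open>\<lambda>1 + \<lambda>2 \<ge> 1\<close>. If moreover \<open>\<lambda>1 < 1/2\<close>, then both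
  \<open>A = \<lambda>2 \<ge> 1 - \<lambda>1\<close> and \<open>B \<ge> 1 - \<lambda>1\<close> exceed \<open>\<lambda>1\<close>, so nothing in the first equation can cancel
  the coefficient of \<open>q^\<lambda>1\<close>.

  Sufficiency: \<open>b = 0\<close> and \<open>\<delta>1 = 0\<close> with \<open>A = \<lambda>2\<close> solve the second equation and reduce the first
  to \<open>q^\<lambda>1 = 2 q^\<lambda>2 + q^B e^(-\<delta>2)\<close>. With \<open>B = min \<lambda>1 \<lambda>2\<close>, which is at least \<open>1 - \<lambda>1\<close> exactly
  under the stated inequalities, this asks for a logarithm of \<open>1 - 2 q^d\<close>, of \<open>-1\<close> or of
  \<open>q^d - 2\<close> (\<open>balancing_exponent\<close>). Such logarithms come from formal power series:
  substituting \<open>q^d\<close> for the variable is a multiplicative map that turns composition with the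
  formal exponential into the exponential of the Novikov ring, so the formal logarithm and a
  complex logarithm of the constant term suffice (\<open>fps_at_qpow_is_nexp\<close>).
\<close>

section \<open>Derivatives of the potential\<close>

text \<open>The ultrametric inequality: a sum has no exponent below those of its summands.\<close>

lemma nov_norm_add_le:
  assumes "nov_norm a \<le> r" "nov_norm b \<le> r"
  shows "nov_norm (a + b) \<le> r"
proof (cases "0 < r")
  case True
  define v where "v = - ln r"
  have r: "r = exp (- v)" using True by (simp add: v_def)
  show ?thesis using assms unfolding r nov_norm_le_iff by (simp add: coeff_add)
next
  case False
  have zero: "c = 0" if "nov_norm c \<le> r" for c
  proof (rule ccontr)
    assume "c \<noteq> 0"
    then have "0 < nov_norm c" by (simp add: nov_norm_def)
    then show False using that False by simp
  qed
  have "a = 0" "b = 0" using zero assms by blast+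
  then show ?thesis using assms by simp
qed

text \<open>All exponents are nonnegative, so multiplication cannot lower the least one.\<close>

lemma nov_norm_mult_le: "nov_norm (a * b) \<le> nov_norm b"
proof (cases "b = 0")
  case False
  define v where "v = Inf {x. coeff b x \<noteq> 0}"
  have nb: "nov_norm b = exp (- v)" using False by (simp add: nov_norm_def v_def)
  then have bv: "coeff b x = 0" if "x < v" for x
    using that nov_norm_le_iff[of b v] by simp
  show ?thesis
    unfolding nb nov_norm_le_iff
    using coeff_times_eq_0[of 0 a v b] coeff_neg bv by simp
qed (simp add: nov_norm_def)

lemma has_nov_derivative_const: "has_nov_derivative (\<lambda>x. c) 0 b"
  unfolding has_nov_derivative_def
  by (auto simp: nov_norm_def intro!: exI[of _ 1])

lemma has_nov_derivative_add:
  assumes "has_nov_derivative F D b" "has_nov_derivative G E b"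
  shows "has_nov_derivative (\<lambda>x. F x + G x) (D + E) b"
  unfolding has_nov_derivative_def
proof (intro allI impI)
  fix e :: real assume e: "0 < e"
  obtain d where d: "0 < d"
    and D: "\<And>h. nov_norm h < d \<Longrightarrow> nov_norm (F (b + h) - F b - D * h) \<le> e * nov_norm h"
    using assms(1)[unfolded has_nov_derivative_def, rule_format, OF e] by auto
  obtain d' where d': "0 < d'"
    and D': "\<And>h. nov_norm h < d' \<Longrightarrow> nov_norm (G (b + h) - G b - E * h) \<le> e * nov_norm h"
    using assms(2)[unfolded has_nov_derivative_def, rule_format, OF e] by auto
  show "\<exists>d>0. \<forall>h. nov_norm h < d \<longrightarrow>
      nov_norm (F (b + h) + G (b + h) - (F b + G b) - (D + E) * h) \<le> e * nov_norm h"
  proof (intro exI[of _ "min d d'"] conjI allI impI)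
    fix h assume "nov_norm h < min d d'"
    then have "nov_norm ((F (b + h) - F b - D * h) + (G (b + h) - G b - E * h)) \<le> e * nov_norm h"
      by (intro nov_norm_add_le D D') simp_all
    then show "nov_norm (F (b + h) + G (b + h) - (F b + G b) - (D + E) * h) \<le> e * nov_norm h"
      by (simp add: algebra_simps)
  qed (use d d' in simp)
qed

lemma has_nov_derivative_cmult:
  assumes "has_nov_derivative F D b"
  shows "has_nov_derivative (\<lambda>x. c * F x) (c * D) b"
  unfolding has_nov_derivative_def
proof (intro allI impI)
  fix e :: real assume e: "0 < e"
  obtain d where d: "0 < d"
    and D: "\<And>h. nov_norm h < d \<Longrightarrow> nov_norm (F (b + h) - F b - D * h) \<le> e * nov_norm h"
    using assms(1)[unfolded has_nov_derivative_def, rule_format, OF e] by auto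
  have "nov_norm (c * F (b + h) - c * F b - c * D * h) \<le> e * nov_norm h"
    if "nov_norm h < d" for h
    using order_trans[OF nov_norm_mult_le[of c] D[OF that]] by (simp add: algebra_simps)
  then show "\<exists>d>0. \<forall>h. nov_norm h < d \<longrightarrow>
      nov_norm (c * F (b + h) - c * F b - c * D * h) \<le> e * nov_norm h"
    using d by blast
qed

text \<open>
  The chain rule for an affine inner function. The increment \<open>k * h\<close> is no larger than \<open>h\<close>, so
  the radius and the error bound of \<open>F\<close> carry over unchanged.
\<close>

lemma has_nov_derivative_affine:
  assumes "has_nov_derivative F D (k * b + c)"
  shows "has_nov_derivative (\<lambda>x. F (k * x + c)) (k * D) b"
  unfolding has_nov_derivative_def
proof (intro allI impI)
  fix e :: real assume e: "0 < e"
  obtain d where d: "0 < d"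
    and D: "\<And>h. nov_norm h < d \<Longrightarrow>
      nov_norm (F (k * b + c + h) - F (k * b + c) - D * h) \<le> e * nov_norm h"
    using assms(1)[unfolded has_nov_derivative_def, rule_format, OF e] by auto
  have "nov_norm (F (k * (b + h) + c) - F (k * b + c) - k * D * h) \<le> e * nov_norm h"
    if h: "nov_norm h < d" for h
  proof -
    have "nov_norm (F (k * b + c + k * h) - F (k * b + c) - D * (k * h)) \<le> e * nov_norm (k * h)"
      by (rule D) (use nov_norm_mult_le[of k h] h in simp)
    also have "\<dots> \<le> e * nov_norm h"
      using e by (intro mult_left_mono nov_norm_mult_le) simp
    finally show ?thesis by (simp add: algebra_simps)
  qed
  then show "\<exists>d>0. \<forall>h. nov_norm h < d \<longrightarrow>
      nov_norm (F (k * (b + h) + c) - F (k * b + c) - k * D * h) \<le> e * nov_norm h"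
    using d by blast
qed

text \<open>
  Uniqueness of the derivative turns the vanishing of each partial derivative into the equation
  that sets the formally computed one to zero.
\<close>

lemma critical_point_potential_iff:
  "critical_point (potential (l1, l2) (\<epsilon>1, \<epsilon>2) (\<delta>1, \<delta>2)) (b1, b2) \<longleftrightarrow>
     qpow l1 * nexp b1 = 2 * (qpow (- 2 * l1 - l2 - \<epsilon>1) * nexp (- 2 * b1 - b2 - \<delta>1))
       + qpow (- l1 - \<epsilon>2) * nexp (- b1 - \<delta>2) \<and>
     qpow l2 * nexp b2 = qpow (- 2 * l1 - l2 - \<epsilon>1) * nexp (- 2 * b1 - b2 - \<delta>1)"
proof -
  let ?W = "potential (l1, l2) (\<epsilon>1, \<epsilon>2) (\<delta>1, \<delta>2)"
  let ?u = "qpow (- 2 * l1 - l2 - \<epsilon>1)" and ?v = "qpow (- l1 - \<epsilon>2)"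
  let ?U = "nexp (- 2 * b1 - b2 - \<delta>1)" and ?V = "nexp (- b1 - \<delta>2)"
  \<comment> \<open>In each variable, the exponents of the potential are affine functions.\<close>
  have shift: "(- 2) * x + (- b2 - \<delta>1) = - 2 * x - b2 - \<delta>1" "(- 1) * x + (- \<delta>2) = - x - \<delta>2"
    "(- 1) * x + (- 2 * b1 - \<delta>1) = - 2 * b1 - x - \<delta>1" for x
    by simp_all
  have "has_nov_derivative (\<lambda>x. qpow l1 * nexp x + qpow l2 * nexp b2
      + ?u * nexp ((- 2) * x + (- b2 - \<delta>1)) + ?v * nexp ((- 1) * x + (- \<delta>2)))
    (qpow l1 * nexp b1 + 0 + ?u * ((- 2) * nexp ((- 2) * b1 + (- b2 - \<delta>1)))
      + ?v * ((- 1) * nexp ((- 1) * b1 + (- \<delta>2)))) b1"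
    by (intro has_nov_derivative_add has_nov_derivative_cmult has_nov_derivative_affine
        nexp_has_nov_derivative has_nov_derivative_const)
  note this[unfolded shift]
  then have 1: "has_partial1 ?W (qpow l1 * nexp b1 - 2 * (?u * ?U) - ?v * ?V) (b1, b2)"
    by (simp add: has_partial1_def potential_def mult.left_commute)
  have "has_nov_derivative (\<lambda>x. qpow l1 * nexp b1 + qpow l2 * nexp x
      + ?u * nexp ((- 1) * x + (- 2 * b1 - \<delta>1)) + ?v * nexp (- b1 - \<delta>2))
    (0 + qpow l2 * nexp b2 + ?u * ((- 1) * nexp ((- 1) * b2 + (- 2 * b1 - \<delta>1))) + 0) b2"
    by (intro has_nov_derivative_add has_nov_derivative_cmult has_nov_derivative_affine
        nexp_has_nov_derivative has_nov_derivative_const)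
  note this[unfolded shift]
  then have 2: "has_partial2 ?W (qpow l2 * nexp b2 - ?u * ?U) (b1, b2)"
    by (simp add: has_partial2_def potential_def)
  have "has_partial1 ?W 0 (b1, b2) \<longleftrightarrow> qpow l1 * nexp b1 - 2 * (?u * ?U) - ?v * ?V = 0"
    using 1 has_nov_derivative_unique unfolding has_partial1_def by metis
  moreover have "has_partial2 ?W 0 (b1, b2) \<longleftrightarrow> qpow l2 * nexp b2 - ?u * ?U = 0"
    using 2 has_nov_derivative_unique unfolding has_partial2_def by metis
  ultimately show ?thesis
    by (simp add: critical_point_def diff_diff_eq)
qed

section \<open>Leading coefficients\<close>

lemma coeff_qpow_mult: "0 \<le> d \<Longrightarrow> coeff (qpow d * a) x = coeff a (x - d)"
  using coeff_times_qpow[of d a x] by (simp add: mult.commute)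

lemma qpow_add: "0 \<le> d \<Longrightarrow> 0 \<le> e \<Longrightarrow> qpow d * qpow e = qpow (d + e)"
  by (rule novikov_eqI) (simp add: coeff_qpow_mult qpow.rep_eq)

lemma nexp_zero: "nexp 0 = 1"
proof (rule novikov_eqI)
  fix x
  have "coeff (nexp 0) x = (\<Sum>n\<in>{0}. coeff (0 ^ n) x / fact n)"
    unfolding coeff_nexp by (rule suminf_finite) (auto simp: power_0_left)
  then show "coeff (nexp 0) x = coeff 1 x" by simp
qed

text \<open>
  An exponential is a unit with inverse \<open>nexp (- b)\<close>; as exponents are nonnegative, the constant
  term of the product \<open>1\<close> can only come from the two constant terms.
\<close>

lemma coeff_nexp_0: "coeff (nexp b) 0 \<noteq> 0"
proof -
  have "coeff (nexp b * nexp (- b)) 0 \<noteq> 0"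
    by (simp add: nexp_add[symmetric] nexp_zero coeff_one)
  then obtain y z where "coeff (nexp b) y \<noteq> 0" "coeff (nexp (- b)) z \<noteq> 0" "0 = y + z"
    by (rule coeff_times_nz)
  moreover from this have "0 \<le> y" "0 \<le> z"
    using coeff_neg not_less by blast+
  ultimately have "y = 0" by linarith
  with \<open>coeff (nexp b) y \<noteq> 0\<close> show ?thesis by simp
qed

section \<open>Logarithms of power series in a power of q\<close>

text \<open>
  The value of the power series \<open>f\<close> at \<open>q^d\<close>. For \<open>d > 0\<close> the exponents tend to infinity, so the
  value exists without any convergence condition on \<open>f\<close>.
\<close>

definition fps_at_qpow :: "real \<Rightarrow> complex fps \<Rightarrow> novikov" where
  "fps_at_qpow d f = Abs_novikov (sum_coeff (fps_nth f) (\<lambda>n. real n * d))"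

context
  fixes d :: real
  assumes d: "0 < d"
begin

lemma coeff_fps_at_qpow_eq: "coeff (fps_at_qpow d f) = sum_coeff (fps_nth f) (\<lambda>n. real n * d)"
proof -
  have "filterlim (\<lambda>n. real n * d) at_top sequentially"
    using filterlim_at_top_mult_tendsto_pos[OF tendsto_const d filterlim_real_sequentially]
    by (simp add: mult.commute)
  moreover have "\<forall>n. 0 \<le> real n * d" using d by simp
  ultimately show ?thesis
    unfolding fps_at_qpow_def by (intro Abs_novikov_inverse) blast
qed

lemma coeff_fps_at_qpow: "coeff (fps_at_qpow d f) (real n * d) = fps_nth f n"
proof -
  have "{m. real m * d = real n * d} = {n}" using d by auto
  then show ?thesis by (simp add: coeff_fps_at_qpow_eq sum_coeff_def)
qed

lemma coeff_fps_at_qpow_other: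
  assumes "\<And>n. x \<noteq> real n * d"
  shows "coeff (fps_at_qpow d f) x = 0"
proof -
  have "{m. real m * d = x} = {}" using assms by auto
  then show ?thesis by (simp add: coeff_fps_at_qpow_eq sum_coeff_def)
qed

lemma eq_fps_at_qpowI:
  assumes "\<And>n. coeff a (real n * d) = fps_nth f n"
    and "\<And>x. (\<And>n. x \<noteq> real n * d) \<Longrightarrow> coeff a x = 0"
  shows "a = fps_at_qpow d f"
proof (rule novikov_eqI)
  show "coeff a x = coeff (fps_at_qpow d f) x" for x
    using assms coeff_fps_at_qpow coeff_fps_at_qpow_other by (cases "\<exists>n. x = real n * d") auto
qed

lemma fps_at_qpow_one: "fps_at_qpow d 1 = 1"
proof (rule eq_fps_at_qpowI[symmetric])
  fix x assume "\<And>n. x \<noteq> real n * d"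
  from this[of 0] show "coeff 1 x = 0" by (simp add: coeff_one)
qed (use d in \<open>simp add: coeff_one\<close>)

lemma fps_at_qpow_X: "fps_at_qpow d fps_X = qpow d"
proof (rule eq_fps_at_qpowI[symmetric])
  fix x assume "\<And>n. x \<noteq> real n * d"
  from this[of 1] show "coeff (qpow d) x = 0" by (simp add: qpow.rep_eq)
qed (use d in \<open>auto simp: qpow.rep_eq fps_X_def\<close>)

lemma fps_at_qpow_diff: "fps_at_qpow d (f - g) = fps_at_qpow d f - fps_at_qpow d g"
  by (rule eq_fps_at_qpowI[symmetric])
    (simp_all add: coeff_diff coeff_fps_at_qpow coeff_fps_at_qpow_other)

lemma fps_at_qpow_mult: "fps_at_qpow d (f * g) = fps_at_qpow d f * fps_at_qpow d g"
proof (rule eq_fps_at_qpowI[symmetric])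
  fix x assume x: "\<And>n. x \<noteq> real n * d"
  show "coeff (fps_at_qpow d f * fps_at_qpow d g) x = 0"
  proof (rule ccontr)
    assume "coeff (fps_at_qpow d f * fps_at_qpow d g) x \<noteq> 0"
    then obtain y z where yz: "coeff (fps_at_qpow d f) y \<noteq> 0" "coeff (fps_at_qpow d g) z \<noteq> 0"
      and sum: "x = y + z"
      by (rule coeff_times_nz)
    from yz obtain m n where "y = real m * d" "z = real n * d"
      using coeff_fps_at_qpow_other by metis
    then show False using x[of "m + n"] sum by (simp add: distrib_right)
  qed
next
  fix n
  let ?A = "(\<lambda>k. real k * d) ` {..n}"
  have inj: "inj_on (\<lambda>k. real k * d) {..n}" using d by (simp add: inj_on_def)
  have supp: "y \<in> ?A" if nz: "coeff (fps_at_qpow d h) y \<noteq> 0" and le: "y \<le> real n * d" for h y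
  proof -
    obtain m where "y = real m * d" using nz coeff_fps_at_qpow_other[of y h] by blast
    then show ?thesis using le d by simp
  qed
  have "coeff (fps_at_qpow d f * fps_at_qpow d g) (real n * d) =
      (\<Sum>y\<in>?A. \<Sum>z\<in>?A. if y + z = real n * d
        then coeff (fps_at_qpow d f) y * coeff (fps_at_qpow d g) z else 0)"
    by (rule coeff_times_pairs) (use supp in auto)
  also have "\<dots> = (\<Sum>i\<le>n. \<Sum>j\<le>n. if real i * d + real j * d = real n * d
        then fps_nth f i * fps_nth g j else 0)"
    by (simp add: sum.reindex[OF inj] coeff_fps_at_qpow cong: if_cong)
  also have "\<dots> = (\<Sum>i\<le>n. \<Sum>j\<le>n. if j = n - i then fps_nth f i * fps_nth g j else 0)"
  proof (intro sum.cong refl)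
    fix i j assume "i \<in> {..n}"
    have "real i * d + real j * d = real n * d \<longleftrightarrow> real (i + j) = real n"
      using d by (simp add: distrib_right[symmetric])
    also have "\<dots> \<longleftrightarrow> j = n - i"
      using \<open>i \<in> {..n}\<close> by (simp only: of_nat_eq_iff) auto
    finally show "(if real i * d + real j * d = real n * d then fps_nth f i * fps_nth g j else 0)
      = (if j = n - i then fps_nth f i * fps_nth g j else 0)" by simp
  qed
  also have "\<dots> = fps_nth (f * g) n"
    by (simp add: fps_mult_nth atMost_atLeast0)
  finally show "coeff (fps_at_qpow d f * fps_at_qpow d g) (real n * d) = fps_nth (f * g) n" .
qed

lemma fps_at_qpow_power: "fps_at_qpow d (f ^ n) = fps_at_qpow d f ^ n"
  by (induction n) (simp_all add: fps_at_qpow_one fps_at_qpow_mult)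

text \<open>
  Without a constant term, \<open>f ^ n\<close> starts at degree \<open>n\<close>. Hence each coefficient of the
  exponential is a finite sum, and it is the sum that defines the formal composition.
\<close>

lemma nexp_fps_at_qpow:
  assumes "fps_nth f 0 = 0"
  shows "nexp (fps_at_qpow d f) = fps_at_qpow d (fps_exp 1 oo f)"
proof (rule eq_fps_at_qpowI)
  fix k
  have "coeff (nexp (fps_at_qpow d f)) (real k * d) = (\<Sum>n. fps_nth (f ^ n) k / fact n)"
    by (simp add: coeff_nexp fps_at_qpow_power[symmetric] coeff_fps_at_qpow)
  also have "\<dots> = (\<Sum>n\<in>{0..k}. fps_nth (f ^ n) k / fact n)"
    by (rule suminf_finite) (use startsby_zero_power_prefix[OF assms] in auto)
  also have "\<dots> = fps_nth (fps_exp 1 oo f) k"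
    by (simp add: fps_compose_nth)
  finally show "coeff (nexp (fps_at_qpow d f)) (real k * d) = fps_nth (fps_exp 1 oo f) k" .
qed (simp add: coeff_nexp fps_at_qpow_power[symmetric] coeff_fps_at_qpow_other)

lemma nexp_fps_at_qpow_const:
  "nexp (fps_at_qpow d (fps_const c)) = fps_at_qpow d (fps_const (exp c))"
proof (rule eq_fps_at_qpowI)
  fix k
  have "coeff (nexp (fps_at_qpow d (fps_const c))) (real k * d)
      = (\<Sum>n. fps_nth (fps_const (c ^ n)) k / fact n)"
    by (simp add: coeff_nexp fps_at_qpow_power[symmetric] coeff_fps_at_qpow)
  also have "\<dots> = fps_nth (fps_const (exp c)) k"
    by (cases "k = 0") (simp_all add: exp_def scaleR_conv_of_real field_simps)
  finally show "coeff (nexp (fps_at_qpow d (fps_const c))) (real k * d)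
    = fps_nth (fps_const (exp c)) k" .
qed (simp add: coeff_nexp fps_at_qpow_power[symmetric] coeff_fps_at_qpow_other)

text \<open>
  Factor \<open>f = c (1 + g)\<close> with \<open>g\<close> free of a constant term. The logarithm of \<open>f\<close> is \<open>Ln c\<close> plus the
  formal logarithm of \<open>1 + g\<close>; only the first involves analytic convergence.
\<close>

lemma fps_at_qpow_is_nexp:
  assumes "fps_nth f 0 \<noteq> 0"
  shows "\<exists>a. nexp a = fps_at_qpow d f"
proof -
  define c where "c = fps_nth f 0"
  define g where "g = fps_const (1 / c) * f - 1"
  have c: "c \<noteq> 0" using assms by (simp add: c_def)
  have g0: "fps_nth g 0 = 0" using c by (simp add: g_def c_def)
  have f: "f = fps_const c * (1 + g)"
    using c by (simp add: g_def mult.assoc[symmetric])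
  let ?l = "fps_ln 1 oo g :: complex fps"
  have l0: "fps_nth ?l 0 = 0" by (simp add: fps_ln_0)
  have "(fps_exp 1 - 1) oo ?l = ((fps_exp 1 - 1) oo fps_ln 1) oo g"
    by (rule fps_compose_assoc) (simp_all add: g0 fps_ln_0)
  also have "(fps_exp 1 - 1 :: complex fps) oo fps_ln 1 = fps_X"
    by (simp add: fps_ln_fps_exp_inv fps_inv_right)
  finally have "(fps_exp 1 - 1) oo ?l = g" using g0 by simp
  then have expl: "fps_exp 1 oo ?l = 1 + g"
    by (simp add: fps_compose_sub_distrib algebra_simps)
  have "nexp (fps_at_qpow d (fps_const (Ln c)) + fps_at_qpow d ?l) = fps_at_qpow d f"
    unfolding nexp_add nexp_fps_at_qpow_const nexp_fps_at_qpow[OF l0] expl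
    using c f by (simp add: fps_at_qpow_mult[symmetric])
  then show ?thesis by blast
qed

end

section \<open>The critical locus\<close>

text \<open>
  The lowest terms of the two critical point equations: at \<open>q^l2\<close> for the second, at \<open>q^l1\<close> for
  the first.
\<close>

lemma critical_point_imp:
  fixes l1 l2 :: real
  assumes l: "0 \<le> l1" "0 \<le> l2" "2 * l1 + l2 < 2" "l1 < 1"
    and \<epsilon>: "\<epsilon>1 \<le> - 2" "\<epsilon>2 \<le> - 1"
    and crit: "critical_point (potential (l1, l2) (\<epsilon>1, \<epsilon>2) (\<delta>1, \<delta>2)) (b1, b2)"
  shows "l1 + l2 \<ge> 1 \<and> l1 \<ge> 1 / 2"
proof -
  define A where "A = - 2 * l1 - l2 - \<epsilon>1"
  define B where "B = - l1 - \<epsilon>2"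
  define U where "U = nexp (- 2 * b1 - b2 - \<delta>1)"
  define V where "V = nexp (- b1 - \<delta>2)"
  have eq1: "qpow l1 * nexp b1 = 2 * (qpow A * U) + qpow B * V"
    and eq2: "qpow l2 * nexp b2 = qpow A * U"
    using crit unfolding critical_point_potential_iff A_def B_def U_def V_def by blast+
  have AB: "0 \<le> A" "0 \<le> B" using l \<epsilon> by (simp_all add: A_def B_def)
  have eq2': "coeff (nexp b2) (x - l2) = coeff U (x - A)" for x
    using arg_cong[OF eq2, of "\<lambda>a. coeff a x"] l AB by (simp add: coeff_qpow_mult)
  have "\<not> l2 < A"
    using eq2'[of l2] coeff_nexp_0[of b2] coeff_neg[of "l2 - A" U] by auto
  moreover have "\<not> A < l2"
    using eq2'[of A] coeff_nexp_0[of "- 2 * b1 - b2 - \<delta>1"] coeff_neg[of "A - l2" "nexp b2"]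
    by (auto simp: U_def)
  ultimately have A: "A = l2" by simp
  then have s: "1 \<le> l1 + l2" using \<epsilon> by (simp add: A_def)
  have eq1': "coeff (nexp b1) 0 = 2 * coeff U (l1 - A) + coeff V (l1 - B)"
    using arg_cong[OF eq1, of "\<lambda>a. coeff a l1"] l AB
    by (simp add: coeff_qpow_mult coeff_add coeff_of_nat_mult[of 2, simplified])
  have "1 / 2 \<le> l1"
  proof (rule ccontr)
    assume "\<not> 1 / 2 \<le> l1"
    then have "l1 - A < 0" "l1 - B < 0" using s A \<epsilon> by (simp_all add: B_def)
    then show False using eq1' coeff_nexp_0[of b1] by (simp add: coeff_neg)
  qed
  with s show ?thesis by simp
qed

text \<open>
  After division by \<open>q^(min l1 l2)\<close>, the difference \<open>q^l1 - 2 q^l2\<close> is a linear polynomial in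
  \<open>q^\<bar>l1 - l2\<bar>\<close> with constant term \<open>1\<close>, \<open>-1\<close> or \<open>-2\<close>, and therefore an exponential. When
  \<open>l1 = l2\<close> it is a constant, and any positive power of \<open>q\<close> serves as the variable.
\<close>

lemma balancing_exponent:
  fixes l1 l2 :: real
  assumes "0 \<le> l1" "0 \<le> l2"
  obtains a where "qpow l1 = 2 * qpow l2 + qpow (min l1 l2) * nexp a"
proof -
  consider "l1 < l2" | "l1 = l2" | "l2 < l1" by linarith
  then show ?thesis
  proof cases
    case 1
    then have d: "0 < l2 - l1" by simp
    obtain a where "nexp a = fps_at_qpow (l2 - l1) (1 - fps_X - fps_X)"
      using fps_at_qpow_is_nexp[OF d, of "1 - fps_X - fps_X"] by auto
    then have a: "nexp a = 1 - 2 * qpow (l2 - l1)"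
      by (simp only: fps_at_qpow_diff[OF d] fps_at_qpow_one[OF d] fps_at_qpow_X[OF d]) simp
    have "qpow l1 * qpow (l2 - l1) = qpow l2" using 1 assms by (simp add: qpow_add)
    moreover have "qpow l1 * nexp a = qpow l1 - 2 * (qpow l1 * qpow (l2 - l1))"
      unfolding a by (simp only: right_diff_distrib mult_1_right mult.left_commute)
    ultimately have "qpow l1 * nexp a = qpow l1 - 2 * qpow l2" by simp
    then show ?thesis using 1 by (intro that[of a]) simp
  next
    case 2
    have d: "0 < (1 :: real)" by simp
    obtain a where "nexp a = fps_at_qpow 1 (1 - 1 - 1)"
      using fps_at_qpow_is_nexp[OF d, of "1 - 1 - 1"] by auto
    then have a: "nexp a = - 1"
      by (simp only: fps_at_qpow_diff[OF d] fps_at_qpow_one[OF d]) simp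
    show ?thesis using 2 a by (intro that[of a]) (simp add: algebra_simps)
  next
    case 3
    then have d: "0 < l1 - l2" by simp
    obtain a where "nexp a = fps_at_qpow (l1 - l2) (fps_X - 1 - 1)"
      using fps_at_qpow_is_nexp[OF d, of "fps_X - 1 - 1"] by auto
    then have a: "nexp a = qpow (l1 - l2) - 2"
      by (simp only: fps_at_qpow_diff[OF d] fps_at_qpow_one[OF d] fps_at_qpow_X[OF d]) simp
    have "qpow l2 * qpow (l1 - l2) = qpow l1" using 3 assms by (simp add: qpow_add)
    then have "qpow l2 * nexp a = qpow l1 - 2 * qpow l2"
      unfolding a by (simp add: algebra_simps)
    then show ?thesis using 3 by (intro that[of a]) simp
  qed
qed

theorem mainTheorem4:
  fixes l1 l2 :: real
  assumes "(l1, l2) \<in> interior (moment_map ` ellipsoid)"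
  shows "(\<exists>\<epsilon>1 \<epsilon>2 :: real. \<exists>\<delta> :: novikov \<times> novikov. \<epsilon>1 \<le> - 2 \<and> \<epsilon>2 \<le> - 1 \<and>
            (\<exists>b. critical_point (potential (l1, l2) (\<epsilon>1, \<epsilon>2) \<delta>) b))
         \<longleftrightarrow> l1 + l2 \<ge> 1 \<and> l1 \<ge> 1 / 2"
    (is "?L \<longleftrightarrow> ?R")
proof
  have "(l1, l2) \<in> moment_map ` ellipsoid"
    using assms interior_subset by blast
  then have l: "0 \<le> l1" "0 \<le> l2" "2 * l1 + l2 < 2" "l1 < 1"
    unfolding moment_image_ellipsoid by auto
  show ?R if ?L
    using that critical_point_imp[OF l] by (metis surj_pair)
  show ?L if ?R
  proof -
    obtain a where a: "qpow l1 = 2 * qpow l2 + qpow (min l1 l2) * nexp a"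
      using balancing_exponent[OF l(1,2)] .
    \<comment> \<open>These make the last two exponents of the potential equal to l2 and min l1 l2.\<close>
    define \<epsilon>1 where "\<epsilon>1 = - 2 * (l1 + l2)"
    define \<epsilon>2 where "\<epsilon>2 = - l1 - min l1 l2"
    have \<epsilon>: "\<epsilon>1 \<le> - 2" "\<epsilon>2 \<le> - 1" using that by (auto simp: \<epsilon>1_def \<epsilon>2_def)
    have AB: "- 2 * l1 - l2 - \<epsilon>1 = l2" "- l1 - \<epsilon>2 = min l1 l2"
      by (simp_all add: \<epsilon>1_def \<epsilon>2_def)
    have "critical_point (potential (l1, l2) (\<epsilon>1, \<epsilon>2) (0, - a)) (0, 0)"
      unfolding critical_point_potential_iff AB using a by (simp add: nexp_zero)
    with \<epsilon> show ?L by blast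
  qed
qed

end
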